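(* Let $A$ be an $m\times m$ matrix-valued function with entries in $\mathcal N^\infty$ such that $\det A\neq0$, and let $\Phi=[\varphi_1,\cdots,\varphi_r]\in L^2_{M_{m\times r}}$. Let $\psi_i$ denote the $i$-th column of $\Psi:=A\Phi$. Then $\mathrm{ind}_{\mathcal N}\{\varphi_1,\cdots,\varphi_r\}=\mathrm{ind}_{\mathcal N}\{\psi_1,\cdots,\psi_r\}$.
   Context: $\mathbb T$ is the unit circle. The Nevanlinna class $\mathcal N$ is the set of functions on $\mathbb T$ of the form $f/g$ with $f,g\in H^\infty$, $g\neq0$; $\mathcal N^p=\mathcal N\cap L^p$, and $\mathcal N_{\mathbb C^n}$ denotes column vectors with entries in $\mathcal N$. $\det A\neq 0$ means $\det A$ is not the zero function. Vectors $\varphi_1,\dots,\varphi_r\in L^2_{\mathbb C^n}$ are independent modulo Nevanlinna class if $a_1,\dots,a_r\in\mathcal N$ and $\sum a_i\varphi_i\in\mathcal N_{\mathbb C^n}$ imply $a_1=\cdots=a_r=0$. For a finite list $B$ of vectors in $L^2_{\mathbb C^n}$, $\mathrm{ind}_{\mathcal N}B$ is the largest cardinality of a sub-list that is independent modulo Nevanlinna class ($0$ if none). *)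

theory Defs
  imports "HOL-Analysis.Analysis"
begin

text \<open>Functions on the unit circle T are represented as functions complex \<Rightarrow> _,
  of which only the values at cis t, t in [0, 2 pi], matter. Lebesgue measure on T is
  transported from Lebesgue (Borel) measure on [0, 2 pi]; "a.e." refers to this measure.\<close>

definition circle_measure :: "real measure" where
  "circle_measure = restrict_space lborel {0..2*pi}"

definition meas_T :: "(complex \<Rightarrow> 'a::topological_space) \<Rightarrow> bool" where
  "meas_T f \<longleftrightarrow> (\<lambda>t. f (cis t)) \<in> borel_measurable circle_measure"

definition L2_T :: "(complex \<Rightarrow> complex) \<Rightarrow> bool" where
  "L2_T f \<longleftrightarrow> meas_T f \<and> integrable circle_measure (\<lambda>t. norm (f (cis t)) ^ 2)"

definition Linf_T :: "(complex \<Rightarrow> complex) \<Rightarrow> bool" where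
  "Linf_T f \<longleftrightarrow> meas_T f \<and> (\<exists>B. AE t in circle_measure. norm (f (cis t)) \<le> B)"

definition fourier_coeff :: "(complex \<Rightarrow> complex) \<Rightarrow> int \<Rightarrow> complex" where
  "fourier_coeff f n = (LINT t|circle_measure. f (cis t) * cis (- (of_int n * t))) / (2 * pi)"

definition Hinf_T :: "(complex \<Rightarrow> complex) \<Rightarrow> bool" where
  "Hinf_T f \<longleftrightarrow> Linf_T f \<and> (\<forall>n::int. n < 0 \<longrightarrow> fourier_coeff f n = 0)"

definition Nev :: "(complex \<Rightarrow> complex) \<Rightarrow> bool" where
  "Nev f \<longleftrightarrow> (\<exists>h g. Hinf_T h \<and> Hinf_T g \<and> \<not> (AE t in circle_measure. g (cis t) = 0)
                  \<and> (AE t in circle_measure. f (cis t) = h (cis t) / g (cis t)))"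

definition Nev_inf :: "(complex \<Rightarrow> complex) \<Rightarrow> bool" where
  "Nev_inf f \<longleftrightarrow> Nev f \<and> Linf_T f"

definition Nev_vec :: "(complex \<Rightarrow> complex ^ 'n) \<Rightarrow> bool" where
  "Nev_vec v \<longleftrightarrow> (\<forall>i. Nev (\<lambda>z. v z $ i))"

definition indep_mod_N :: "('r \<Rightarrow> complex \<Rightarrow> complex ^ 'n) \<Rightarrow> 'r set \<Rightarrow> bool" where
  "indep_mod_N \<phi> S \<longleftrightarrow>
     (\<forall>a :: 'r \<Rightarrow> complex \<Rightarrow> complex.
        (\<forall>i\<in>S. Nev (a i)) \<and> Nev_vec (\<lambda>z. \<Sum>i\<in>S. a i z *s \<phi> i z)
        \<longrightarrow> (\<forall>i\<in>S. AE t in circle_measure. a i (cis t) = 0))"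

definition ind_N :: "('r::finite \<Rightarrow> complex \<Rightarrow> complex ^ 'n) \<Rightarrow> nat" where
  "ind_N \<phi> = Max (card ` {S. indep_mod_N \<phi> S})"

end

theory Submission
  imports Defs
begin

text \<open>
  Since \<open>\<Sum> a\<^sub>j \<psi>\<^sub>j = A (\<Sum> a\<^sub>j \<phi>\<^sub>j)\<close>, it is enough that a vector \<open>v\<close> has Nevanlinna entries iff \<open>A v\<close> has;
  by Cramer's rule this holds as soon as the Nevanlinna class is a field modulo null sets. The two
  facts behind that are as follows.

  Bounded analytic functions are closed under products: if a trigonometric polynomial is close to
  \<open>f\<close> in \<open>L\<^sup>2\<close>, so is its analytic part, because the antianalytic part is orthogonal to \<open>f\<close>.

  A bounded analytic \<open>g\<close> that vanishes on a set \<open>E\<close> of positive measure is zero (Helson's argument,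
  with minimising sequences in place of projections): let \<open>d\<close> be the infimum of the squared norms of
  \<open>q = g (1 + V)\<close>, \<open>V\<close> an analytic polynomial with \<open>V 0 = 0\<close>. For an almost minimal \<open>q\<close>, comparison with
  \<open>q + c z\<^sup>k q\<close> shows that all nonconstant Fourier coefficients of \<open>\<bar>q\<bar>\<^sup>2\<close> are small, and by
  the parallelogram law \<open>\<bar>q\<bar>\<^sup>2\<close> is \<open>L\<^sup>1\<close>-Cauchy along a minimising sequence. So its limit is a constant that
  vanishes on \<open>E\<close>, whence \<open>d = 0\<close>. As the lowest nonzero Fourier coefficient of \<open>g\<close> is shared by
  all \<open>q\<close>, there is none.
\<close>

section \<open>Bounded measurable functions on the circle\<close>

lemma space_circle_measure [simp]: "space circle_measure = {0..2*pi}"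
  by (simp add: circle_measure_def)

lemma emeasure_circle_measure: "emeasure circle_measure (space circle_measure) = ennreal (2*pi)"
  unfolding circle_measure_def
  by (subst emeasure_restrict_space) auto

interpretation circle: finite_measure circle_measure
  by standard (simp only: emeasure_circle_measure ennreal_neq_top infinity_ennreal_def not_False_eq_True)

lemma measure_circle_measure: "measure circle_measure {0..2*pi} = 2*pi"
  using emeasure_circle_measure by (simp add: measure_def)

lemma borel_measurable_circle:
  "f \<in> borel_measurable borel \<Longrightarrow> f \<in> borel_measurable circle_measure"
  unfolding circle_measure_def by (rule measurable_restrict_space1) simp

text \<open>Functions live in the angle variable. The value type is left general so that one set of
  closure rules serves complex functions and real ones such as squared moduli.\<close>

definition bdd_meas :: "(real \<Rightarrow> 'a::{banach,second_countable_topology,real_normed_field}) \<Rightarrow> bool" where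
  "bdd_meas f \<longleftrightarrow> f \<in> borel_measurable circle_measure \<and> (\<exists>B. AE t in circle_measure. norm (f t) \<le> B)"

lemma bdd_measI:
  assumes "f \<in> borel_measurable circle_measure" "AE t in circle_measure. norm (f t) \<le> B"
  shows "bdd_meas f"
  using assms unfolding bdd_meas_def by blast

lemma bdd_meas_measurable [measurable_dest]: "bdd_meas f \<Longrightarrow> f \<in> borel_measurable circle_measure"
  by (simp add: bdd_meas_def)

lemma bdd_meas_bound:
  assumes "bdd_meas f"
  obtains B where "B > 0" "AE t in circle_measure. norm (f t) \<le> B"
proof -
  obtain B where "AE t in circle_measure. norm (f t) \<le> B"
    using assms unfolding bdd_meas_def by blast
  then have "AE t in circle_measure. norm (f t) \<le> max B 1"
    by eventually_elim auto
  then show ?thesis using that[of "max B 1"] by auto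
qed

lemma bdd_meas_integrable [simp]: "bdd_meas f \<Longrightarrow> integrable circle_measure f"
  by (metis bdd_meas_def circle.integrable_const_bound)

lemma bdd_meas_const [simp, intro]: "bdd_meas (\<lambda>t. c)"
  by (rule bdd_measI[of _ "norm c"]) auto

lemma bdd_meas_add [simp, intro]:
  assumes "bdd_meas f" "bdd_meas g" shows "bdd_meas (\<lambda>t. f t + g t)"
proof -
  obtain B C where "AE t in circle_measure. norm (f t) \<le> B" "AE t in circle_measure. norm (g t) \<le> C"
    using assms unfolding bdd_meas_def by blast
  then have "AE t in circle_measure. norm (f t + g t) \<le> B + C"
    by eventually_elim (rule norm_triangle_mono)
  then show ?thesis
    using assms by (intro bdd_measI) (auto dest: bdd_meas_measurable)
qed

lemma bdd_meas_mult [simp, intro]: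
  assumes "bdd_meas f" "bdd_meas g" shows "bdd_meas (\<lambda>t. f t * g t)"
proof -
  obtain B C where "AE t in circle_measure. norm (f t) \<le> B" "AE t in circle_measure. norm (g t) \<le> C"
    using assms unfolding bdd_meas_def by blast
  then have "AE t in circle_measure. norm (f t * g t) \<le> B * C"
    by eventually_elim (simp add: norm_mult mult_mono')
  then show ?thesis
    using assms by (intro bdd_measI) (auto dest: bdd_meas_measurable)
qed

lemma bdd_meas_minus [simp, intro]: "bdd_meas f \<Longrightarrow> bdd_meas (\<lambda>t. - f t)"
  using bdd_meas_mult[OF bdd_meas_const[of "-1"]] by simp

lemma bdd_meas_diff [simp, intro]: "bdd_meas f \<Longrightarrow> bdd_meas g \<Longrightarrow> bdd_meas (\<lambda>t. f t - g t)"
  using bdd_meas_add[of f "\<lambda>t. - g t"] by simp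

lemma bdd_meas_power [simp, intro]: "bdd_meas f \<Longrightarrow> bdd_meas (\<lambda>t. f t ^ n)"
  by (induction n) auto

lemma bdd_meas_norm [simp, intro]: "bdd_meas f \<Longrightarrow> bdd_meas (\<lambda>t. norm (f t))"
  by (auto simp: bdd_meas_def)

lemma bdd_meas_abs [simp, intro]: "bdd_meas f \<Longrightarrow> bdd_meas (\<lambda>t. \<bar>f t :: real\<bar>)"
  using bdd_meas_norm[of f] by simp

lemma bdd_meas_cnj [simp, intro]: "bdd_meas f \<Longrightarrow> bdd_meas (\<lambda>t. cnj (f t))"
  using measurable_compose[OF _ borel_measurable_continuous_onI[of cnj], of f circle_measure]
  by (auto simp: bdd_meas_def intro: continuous_intros)

lemma bdd_meas_of_real [simp, intro]: "bdd_meas f \<Longrightarrow> bdd_meas (\<lambda>t. complex_of_real (f t))"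
  by (auto simp: bdd_meas_def)

lemma bdd_meas_continuous_circle:
  fixes h :: "complex \<Rightarrow> 'a::{banach,second_countable_topology,real_normed_field}"
  assumes "continuous_on (sphere 0 1) h"
  shows "bdd_meas (\<lambda>t. h (cis t))"
proof -
  have c: "continuous_on UNIV (\<lambda>t. h (cis t))"
    by (rule continuous_on_compose2[OF assms]) (auto intro: continuous_intros)
  have "compact (h ` sphere 0 1)"
    using assms by (intro compact_continuous_image) auto
  then have "bounded (h ` sphere 0 1)" by (rule compact_imp_bounded)
  then obtain B where "\<And>z. z \<in> sphere 0 1 \<Longrightarrow> norm (h z) \<le> B"
    unfolding bounded_iff by (metis imageI)
  then have "norm (h (cis t)) \<le> B" for t by simp
  then show ?thesis
    using borel_measurable_continuous_onI[OF c] by (intro bdd_measI) (auto intro: borel_measurable_circle)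
qed

section \<open>Square integrals\<close>

text \<open>The measure has total mass \<open>2*pi\<close>, not 1, which is the source of the
  factors \<open>2*pi\<close> in later estimates.\<close>

definition L2sq :: "(real \<Rightarrow> complex) \<Rightarrow> real" where
  "L2sq u = (LINT t|circle_measure. (norm (u t))^2)"

lemma L2sq_nonneg [simp]: "L2sq u \<ge> 0"
  unfolding L2sq_def by (intro integral_nonneg_AE) simp

text \<open>Boundedness makes all three integrals finite, so the inequality for extended nonnegative
  integrals carries over to real ones.\<close>

lemma Cauchy_Schwarz_circle:
  fixes u v :: "real \<Rightarrow> complex"
  assumes u: "bdd_meas u" and v: "bdd_meas v"
  shows "(LINT t|circle_measure. norm (u t) * norm (v t)) \<le> sqrt (L2sq u * L2sq v)"
proof -
  note [measurable] = bdd_meas_measurable[OF u] bdd_meas_measurable[OF v]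
  define I where "I = (LINT t|circle_measure. norm (u t) * norm (v t))"
  have "I \<ge> 0" unfolding I_def by (intro integral_nonneg_AE) simp
  have nn: "(\<integral>\<^sup>+t. ennreal (norm (u t)) * ennreal (norm (v t)) \<partial>circle_measure) = ennreal I"
    unfolding I_def using u v by (subst nn_integral_eq_integral[symmetric]) (auto simp: ennreal_mult)
  have sq: "(\<integral>\<^sup>+t. (ennreal (norm (w t)))^2 \<partial>circle_measure) = ennreal (L2sq w)" if "bdd_meas w" for w
    unfolding L2sq_def using that by (subst nn_integral_eq_integral[symmetric]) (auto simp: ennreal_power)
  have "(ennreal I)^2 \<le> ennreal (L2sq u) * ennreal (L2sq v)"
    using Cauchy_Schwarz_nn_integral[of "\<lambda>t. ennreal (norm (u t))" circle_measure "\<lambda>t. ennreal (norm (v t))"]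
    unfolding nn sq[OF u] sq[OF v] by simp
  then have "I^2 \<le> L2sq u * L2sq v"
    using \<open>I \<ge> 0\<close> by (simp add: ennreal_power ennreal_mult[symmetric])
  then show ?thesis unfolding I_def by (rule real_le_rsqrt)
qed

lemma norm_integral_le_L2sq:
  fixes u v :: "real \<Rightarrow> complex"
  assumes "bdd_meas u" "bdd_meas v"
  shows "norm (LINT t|circle_measure. u t * v t) \<le> sqrt (L2sq u * L2sq v)"
proof -
  have "norm (LINT t|circle_measure. u t * v t) \<le> (LINT t|circle_measure. norm (u t * v t))"
    by (rule integral_norm_bound)
  then show ?thesis
    using Cauchy_Schwarz_circle[OF assms] by (simp add: norm_mult)
qed

lemma L2sq_add:
  assumes u: "bdd_meas u" and v: "bdd_meas v"
  shows "L2sq (\<lambda>t. u t + v t) = L2sq u + L2sq v + 2 * Re (LINT t|circle_measure. u t * cnj (v t))"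
proof -
  define w where "w t = u t * cnj (v t)" for t
  have w: "integrable circle_measure w"
    using u v by (simp add: w_def [abs_def])
  have "(norm (u t + v t))^2 = (norm (u t))^2 + (norm (v t))^2 + 2 * Re (w t)" for t
    unfolding w_def cmod_power2 by (simp add: power2_eq_square algebra_simps)
  then have "L2sq (\<lambda>t. u t + v t) = L2sq u + L2sq v + 2 * Re (LINT t|circle_measure. w t)"
    unfolding L2sq_def using u v w by (simp flip: integral_Re)
  then show ?thesis by (simp add: w_def)
qed

lemma L2sq_mult_const: "L2sq (\<lambda>t. c * u t) = (norm c)^2 * L2sq u"
  by (simp add: L2sq_def norm_mult power_mult_distrib)

text \<open>Written with the midpoint for use on convex sets: if the midpoint cannot have small
  norm, two almost minimal elements must be close.\<close>

lemma L2sq_parallelogram: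
  assumes "bdd_meas u" "bdd_meas v"
  shows "L2sq (\<lambda>t. u t - v t) = 2 * L2sq u + 2 * L2sq v - 4 * L2sq (\<lambda>t. (u t + v t) / 2)"
proof -
  have "L2sq (\<lambda>t. u t - v t) = L2sq u + L2sq v - 2 * Re (LINT t|circle_measure. u t * cnj (v t))"
    using L2sq_add[of u "\<lambda>t. - v t"] assms by (simp add: L2sq_def)
  moreover have "L2sq (\<lambda>t. (u t + v t) / 2) = L2sq (\<lambda>t. u t + v t) / 4"
    using L2sq_mult_const[of "1/2" "\<lambda>t. u t + v t"] by (simp add: power2_eq_square)
  ultimately show ?thesis using L2sq_add[OF assms] by simp
qed

lemma L2sq_eq_0_imp_AE:
  assumes "bdd_meas u" "L2sq u = 0"
  shows "AE t in circle_measure. u t = 0"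
proof -
  have "AE t in circle_measure. (norm (u t))^2 = 0"
    using assms unfolding L2sq_def by (subst (asm) integral_nonneg_eq_0_iff_AE) auto
  then show ?thesis by simp
qed

section \<open>Trigonometric polynomials\<close>

definition chr :: "int \<Rightarrow> real \<Rightarrow> complex" where
  "chr n t = cis (of_int n * t)"

lemma chr_0 [simp]: "chr 0 t = 1"
  by (simp add: chr_def)

lemma norm_chr [simp]: "norm (chr n t) = 1"
  by (simp add: chr_def)

lemma chr_mult: "chr m t * chr n t = chr (m + n) t"
  by (simp add: chr_def cis_mult ring_distribs)

lemma cnj_chr [simp]: "cnj (chr n t) = chr (- n) t"
  by (simp add: chr_def cis_cnj)

lemma chr_measurable [measurable]: "chr n \<in> borel_measurable borel"
  unfolding chr_def [abs_def] by (intro borel_measurable_continuous_onI continuous_intros)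

lemma bdd_meas_chr [simp, intro]: "bdd_meas (chr n)" "bdd_meas (\<lambda>t. chr n t)"
  by (rule bdd_measI[of _ 1]; simp add: borel_measurable_circle)+

lemma integral_chr: "(LINT t|circle_measure. chr n t) = (if n = 0 then 2 * pi else 0)"
proof (cases "n = 0")
  case True
  then show ?thesis by (simp add: measure_circle_measure scaleR_conv_of_real)
next
  case False
  \<comment> \<open>An antiderivative of the character; it takes equal values at both ends because
    \<open>n\<close> is an integer.\<close>
  define F where "F t = chr n t / (\<i> * of_int n)" for t
  have der: "(F has_vector_derivative chr n t) (at t within {0..2*pi})" for t
  proof -
    have "((\<lambda>z. exp (\<i> * of_int n * z) / (\<i> * of_int n)) has_field_derivative exp (\<i> * of_int n * of_real t)) (at (of_real t))"
      using False by (auto intro!: derivative_eq_intros)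
    from has_vector_derivative_real_field[OF this]
    show ?thesis by (simp add: F_def [abs_def] chr_def cis_conv_exp mult.assoc)
  qed
  have "continuous_on {0..2*pi} (chr n)"
    unfolding chr_def [abs_def] by (intro continuous_intros)
  from has_bochner_integral_FTC_Icc[OF _ der this]
  have "(LINT t|lborel. indicator {0..2*pi} t *\<^sub>R chr n t) = F (2*pi) - F 0"
    by (simp add: has_bochner_integral_iff)
  moreover have "F (2*pi) = F 0"
    using cis_multiple_2pi[of "of_int n"] by (simp add: F_def chr_def mult_ac)
  ultimately show ?thesis
    using False unfolding circle_measure_def by (subst integral_restrict_space) auto
qed

text \<open>Trigonometric polynomials with frequencies in \<open>I\<close>, built one monomial at a
  time so that linearity arguments become inductions. Analytic polynomials are the case
  \<open>{0..}\<close>, those without constant term the case \<open>{1..}\<close>.\<close>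

inductive trig_span :: "int set \<Rightarrow> (real \<Rightarrow> complex) \<Rightarrow> bool" for I where
  trig_span_0: "trig_span I (\<lambda>t. 0)"
| trig_span_step: "trig_span I T \<Longrightarrow> n \<in> I \<Longrightarrow> trig_span I (\<lambda>t. T t + c * chr n t)"

lemma bdd_meas_trig_span [simp, intro]: "trig_span I T \<Longrightarrow> bdd_meas T"
  by (induction rule: trig_span.induct) auto

lemma trig_span_chr: "n \<in> I \<Longrightarrow> trig_span I (\<lambda>t. c * chr n t)"
  using trig_span_step[OF trig_span_0] by simp

lemma trig_span_add:
  assumes "trig_span I T" "trig_span I U" shows "trig_span I (\<lambda>t. T t + U t)"
  using assms(2)
proof induction
  case (trig_span_step U n c)
  from trig_span.trig_span_step[OF trig_span_step.IH trig_span_step.hyps(2), of c]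
  show ?case by (simp add: add.assoc)
qed (use assms(1) in simp)

lemma trig_span_mult:
  assumes "trig_span I T" "trig_span J U" "\<And>m n. m \<in> I \<Longrightarrow> n \<in> J \<Longrightarrow> m + n \<in> K"
  shows "trig_span K (\<lambda>t. T t * U t)"
  using assms(1)
proof induction
  case (trig_span_step T m c)
  have "trig_span K (\<lambda>t. c * chr m t * U t)"
    using assms(2)
  proof induction
    case (trig_span_step U n d)
    from trig_span.trig_span_step[OF trig_span_step.IH assms(3)[OF \<open>m \<in> I\<close> \<open>n \<in> J\<close>], of "c * d"]
    show ?case by (simp add: ring_distribs chr_mult[symmetric] mult_ac)
  qed (auto intro: trig_span_0)
  from trig_span_add[OF trig_span_step.IH this] show ?case by (simp add: ring_distribs)
qed (auto intro: trig_span_0)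

lemma trig_span_cmult: "trig_span I T \<Longrightarrow> trig_span I (\<lambda>t. c * T t)"
  using trig_span_mult[OF trig_span_chr[of 0 "{0}" c], of I T I] by auto

text \<open>Serves to separate analytic from antianalytic parts. If \<open>I\<close> and
  \<open>J\<close> overlap, a common frequency goes to \<open>U\<close>.\<close>

lemma trig_span_split:
  assumes "trig_span (I \<union> J) T"
  obtains U V where "trig_span I U" "trig_span J V" "\<And>t. T t = U t + V t"
  using assms
proof (induction arbitrary: thesis)
  case trig_span_0
  show ?case by (rule trig_span_0[of "\<lambda>t. 0" "\<lambda>t. 0"]) (auto intro: trig_span.intros)
next
  case (trig_span_step T n c)
  from trig_span_step.IH obtain U V where UV: "trig_span I U" "trig_span J V" "\<And>t. T t = U t + V t" by blast
  show ?case
  proof (cases "n \<in> I")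
    case True
    show ?thesis
      by (rule trig_span_step.prems[OF trig_span.trig_span_step[OF UV(1) True, of c] UV(2)]) (simp add: UV(3))
  next
    case False
    then have "n \<in> J" using trig_span_step by auto
    show ?thesis
      by (rule trig_span_step.prems[OF UV(1) trig_span.trig_span_step[OF UV(2) \<open>n \<in> J\<close>, of c]]) (simp add: UV(3))
  qed
qed

lemma integral_mult_trig_span:
  assumes "trig_span I T" "bdd_meas f" "\<And>n. n \<in> I \<Longrightarrow> (LINT t|circle_measure. f t * chr n t) = 0"
  shows "(LINT t|circle_measure. f t * T t) = 0"
  using assms(1)
proof induction
  case (trig_span_step T n c)
  have "(LINT t|circle_measure. f t * (T t + c * chr n t)) =
      (LINT t|circle_measure. f t * T t + c * (f t * chr n t))"
    by (intro Bochner_Integration.integral_cong) (auto simp: algebra_simps)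
  also have "\<dots> = 0"
    using trig_span_step assms by simp
  finally show ?case .
qed simp

lemma trig_span_cnj: "trig_span I T \<Longrightarrow> trig_span (uminus ` I) (\<lambda>t. cnj (T t))"
proof (induction rule: trig_span.induct)
  case (trig_span_step T n c)
  then show ?case
    using trig_span.trig_span_step[of "uminus ` I" _ "- n" "cnj c"] by simp
qed (simp add: trig_span_0)

section \<open>Density of trigonometric polynomials, uniformly and in mean square\<close>

lemma trig_span_polynomial:
  assumes "real_polynomial_function p"
  shows "trig_span UNIV (\<lambda>t. complex_of_real (p (cis t)))"
  using assms
proof (induction rule: real_polynomial_function.induct)
  case (linear f)
  \<comment> \<open>A real linear form on the plane is fixed by its values at 1 and
    \<open>\<i>\<close>; Euler's formulas then leave only the frequencies 1 and -1.\<close>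
  have "f (cis t) = cos t * f 1 + sin t * f \<i>" for t
  proof -
    have "cis t = cos t *\<^sub>R 1 + sin t *\<^sub>R \<i>" by (auto simp: complex_eq_iff)
    then show ?thesis
      by (simp add: bounded_linear.linear[OF linear] linear_add linear_cmul)
  qed
  then have "complex_of_real (f (cis t)) =
      (f 1 / 2 + f \<i> / (2 * \<i>)) * chr 1 t + (f 1 / 2 - f \<i> / (2 * \<i>)) * chr (-1) t" for t
    by (simp add: chr_def complex_eq_iff field_simps)
  then show ?case
    by (simp only:) (intro trig_span_add trig_span_chr UNIV_I)
next
  case (const c)
  show ?case using trig_span_chr[of 0 UNIV c] by simp
next
  case (add f g)
  then show ?case by (simp add: trig_span_add)
next
  case (mult f g)
  then show ?case using trig_span_mult[OF mult.IH] by simp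
qed

text \<open>Stone-Weierstrass gives a polynomial in the two real coordinates; its real and imaginary
  parts become trigonometric polynomials separately.\<close>

lemma trig_span_dense_continuous:
  fixes h :: "complex \<Rightarrow> complex"
  assumes "continuous_on (sphere 0 1) h" "e > 0"
  obtains T where "trig_span UNIV T" "\<And>t. norm (h (cis t) - T t) < e"
proof -
  obtain g where g: "polynomial_function g" "\<And>z. z \<in> sphere 0 1 \<Longrightarrow> norm (h z - g z) < e"
    using Stone_Weierstrass_polynomial_function[of "sphere 0 1" h e] assms by (auto simp del: sphere_cball)
  have "trig_span UNIV (\<lambda>t. complex_of_real ((Re \<circ> g) (cis t)))" "trig_span UNIV (\<lambda>t. complex_of_real ((Im \<circ> g) (cis t)))"
    using g(1) bounded_linear_Re bounded_linear_Im unfolding polynomial_function_def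
    by (auto intro!: trig_span_polynomial simp del: o_apply)
  from trig_span_add[OF this(1) trig_span_cmult[OF this(2), of \<i>]]
  have "trig_span UNIV (\<lambda>t. g (cis t))"
    by (simp add: complex_eq[symmetric])
  then show ?thesis using that g(2) by simp
qed

lemma Arg2pi_cis: "0 \<le> t \<Longrightarrow> t < 2*pi \<Longrightarrow> Arg2pi (cis t) = t"
  by (rule Arg2pi_unique[of 1]) (auto simp: cis_conv_exp)

text \<open>Both endpoints represent the point 1. Without them \<open>cis\<close> is injective on
  the interval and \<open>Arg2pi\<close> inverts it.\<close>

lemma AE_circle_open: "AE t in circle_measure. 0 < t \<and> t < 2*pi"
proof -
  have "AE t in lborel. t \<notin> {0, 2*pi::real}"
    by (intro AE_not_in countable_imp_null_set_lborel) auto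
  then have "AE t in lborel. t \<in> {0..2*pi} \<longrightarrow> 0 < t \<and> t < 2*pi"
    by eventually_elim auto
  then show ?thesis
    unfolding circle_measure_def by (subst AE_restrict_space_iff) auto
qed

text \<open>The factor \<open>min 1 (n * norm (z - 1))\<close> removes the jump of the argument at \<open>z = 1\<close>.\<close>

lemma continuous_on_circle_cutoff:
  fixes G :: "real \<Rightarrow> complex"
  assumes G: "continuous_on UNIV G" and B: "\<And>t. norm (G t) \<le> B"
  shows "continuous_on (sphere 0 1) (\<lambda>z. of_real (min 1 (real n * norm (z - 1))) * G (Arg2pi z))"
proof -
  have "isCont (\<lambda>z. of_real (min 1 (real n * norm (z - 1))) * G (Arg2pi z)) z" if "z \<in> sphere 0 1" for z :: complex
  proof (cases "z = 1")
    case False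
    \<comment> \<open>\<open>Arg2pi\<close> jumps only across the nonnegative real axis, which meets
      the circle at 1 alone.\<close>
    have "z \<notin> \<real>\<^sub>\<ge>\<^sub>0"
    proof
      assume "z \<in> \<real>\<^sub>\<ge>\<^sub>0"
      then obtain r where "z = of_real r" "r \<ge> 0" by (auto elim: nonneg_Reals_cases)
      with that False show False by simp
    qed
    then have "isCont Arg2pi z" by (rule continuous_at_Arg2pi)
    moreover have "isCont G (Arg2pi z)"
      using G by (simp add: continuous_on_eq_continuous_at)
    ultimately have "isCont (\<lambda>z. G (Arg2pi z)) z"
      by (rule isCont_o2)
    then show ?thesis by (intro continuous_intros)
  next
    case True
    have "((\<lambda>z. of_real (min 1 (real n * norm (z - 1))) * G (Arg2pi z)) \<longlongrightarrow> 0) (at 1)"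
    proof (rule Lim_null_comparison)
      show "\<forall>\<^sub>F z in at 1. norm (of_real (min 1 (real n * norm (z - 1))) * G (Arg2pi z)) \<le> real n * norm (z - 1) * B"
      proof (intro always_eventually allI)
        fix z :: complex
        have "\<bar>min 1 (real n * norm (z - 1))\<bar> \<le> real n * norm (z - 1)" by auto
        then show "norm (of_real (min 1 (real n * norm (z - 1))) * G (Arg2pi z)) \<le> real n * norm (z - 1) * B"
          unfolding norm_mult norm_of_real using B by (intro mult_mono) auto
      qed
      have "((\<lambda>z::complex. real n * norm (z - 1) * B) \<longlongrightarrow> real n * norm (1 - 1 :: complex) * B) (at 1)"
        by (intro tendsto_intros)
      then show "((\<lambda>z::complex. real n * norm (z - 1) * B) \<longlongrightarrow> 0) (at 1)" by simp
    qed
    then show ?thesis by (simp add: True isCont_def)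
  qed
  then show ?thesis by (simp add: continuous_at_imp_continuous_on)
qed

text \<open>A measurable function on the line is an a.e. limit of continuous ones. Clipping makes
  these uniformly bounded, and the cutoff near 1 lets them descend to the circle. The common bound
  \<open>B\<close> prepares for dominated convergence.\<close>

lemma continuous_circle_approx:
  fixes f :: "real \<Rightarrow> complex"
  assumes f: "f \<in> borel_measurable circle_measure"
    and B: "AE t in circle_measure. norm (f t) \<le> B" "B > 0"
  obtains h :: "nat \<Rightarrow> complex \<Rightarrow> complex"
  where "\<And>n. continuous_on (sphere 0 1) (h n)" "\<And>n z. norm (h n z) \<le> B"
    "AE t in circle_measure. (\<lambda>n. h n (cis t)) \<longlonglongrightarrow> f t"
proof -
  define f0 where "f0 t = indicator {0..2*pi} t *\<^sub>R f t" for t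
  have "f0 \<in> borel_measurable lborel"
    using f unfolding circle_measure_def f0_def [abs_def]
    by (subst (asm) borel_measurable_restrict_space_iff) auto
  then have "f0 \<in> borel_measurable lebesgue"
    by (rule measurable_completion)
  then have "f0 measurable_on UNIV"
    by (intro lebesgue_measurable_imp_measurable_on) auto
  then obtain N g where N: "negligible N" and g: "\<And>n. continuous_on UNIV (g n)"
    and lim: "\<And>t. t \<notin> N \<Longrightarrow> (\<lambda>n. g n t) \<longlonglongrightarrow> f0 t"
    unfolding measurable_on_def by auto
  have "AE t in lebesgue. t \<notin> N"
    using N by (intro AE_not_in) (simp add: negligible_iff_null_sets)
  then have "AE t in lborel. t \<notin> N"
    by (simp add: AE_completion_iff)
  then have "AE t in lborel. t \<in> {0..2*pi} \<longrightarrow> t \<notin> N" by eventually_elim simp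
  then have AEN: "AE t in circle_measure. t \<notin> N"
    unfolding circle_measure_def by (subst AE_restrict_space_iff) auto
  \<comment> \<open>Radial retraction onto the disc of radius \<open>B\<close>: continuous, and the
    identity on the values of \<open>f\<close> outside a null set, so the limit is not
    changed.\<close>
  define clip :: "complex \<Rightarrow> complex" where "clip w = of_real (B / max B (norm w)) * w" for w
  have clip_le: "norm (clip w) \<le> B" for w
    using \<open>B > 0\<close> by (auto simp: clip_def norm_mult norm_divide field_simps max_def)
  have clip_id: "clip w = w" if "norm w \<le> B" for w
    using that \<open>B > 0\<close> by (simp add: clip_def max_def)
  have clip_cont: "continuous_on UNIV clip"
    unfolding clip_def [abs_def] using \<open>B > 0\<close> by (intro continuous_intros) (auto simp: max_def)
  define h where "h n z = of_real (min 1 (real n * norm (z - 1))) * clip (g n (Arg2pi z))" for n z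
  show thesis
  proof (rule that[of h])
    show "continuous_on (sphere 0 1) (h n)" for n
      unfolding h_def [abs_def]
      by (rule continuous_on_circle_cutoff[OF continuous_on_compose2[OF clip_cont g] clip_le]) auto
    show "norm (h n z) \<le> B" for n z
    proof -
      have "norm (h n z) \<le> 1 * B"
        unfolding h_def norm_mult norm_of_real using clip_le by (intro mult_mono) auto
      then show ?thesis by simp
    qed
    show "AE t in circle_measure. (\<lambda>n. h n (cis t)) \<longlonglongrightarrow> f t"
      using AEN AE_circle_open B(1)
    proof eventually_elim
      case (elim t)
      have "f0 t = f t" using elim by (simp add: f0_def)
      have "(\<lambda>n. clip (g n t)) \<longlonglongrightarrow> clip (f0 t)"
        using clip_cont lim elim
        by (intro continuous_on_tendsto_compose[of UNIV clip]) auto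
      then have 1: "(\<lambda>n. clip (g n t)) \<longlonglongrightarrow> f t"
        using elim \<open>f0 t = f t\<close> clip_id by simp
      have "cis t \<noteq> 1"
      proof
        assume "cis t = 1"
        then have "Arg2pi (cis t) = 0" using Arg2pi_of_real[of 1] by simp
        then show False using Arg2pi_cis[of t] elim by simp
      qed
      then have "norm (cis t - 1) > 0" by simp
      then obtain m where m: "real m * norm (cis t - 1) > 1" using reals_Archimedean3 by blast
      \<comment> \<open>At a fixed point other than 1 the cutoff factor equals 1 for all large
        \<open>n\<close>.\<close>
      have "h n (cis t) = clip (g n t)" if "n \<ge> m" for n
      proof -
        have "real n * norm (cis t - 1) \<ge> real m * norm (cis t - 1)"
          using that by (intro mult_right_mono) auto
        then show ?thesis using m elim by (simp add: h_def Arg2pi_cis min_def)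
      qed
      then show ?case
        using 1 by (subst tendsto_cong[of _ "\<lambda>n. clip (g n t)"]) (auto simp: eventually_sequentially)
    qed
  qed
qed

text \<open>Two approximations in a row: \<open>f\<close> by a continuous function in mean square,
  by dominated convergence, and that function uniformly by a trigonometric polynomial.\<close>

lemma trig_span_dense_L2:
  assumes f: "bdd_meas f" and "e > 0"
  obtains T where "trig_span UNIV T" "L2sq (\<lambda>t. f t - T t) < e"
proof -
  obtain B where B: "B > 0" "AE t in circle_measure. norm (f t) \<le> B"
    using bdd_meas_bound[OF f] by blast
  obtain h where h: "\<And>n. continuous_on (sphere 0 1) (h n)" "\<And>n z. norm (h n z) \<le> B"
      "AE t in circle_measure. (\<lambda>n. h n (cis t)) \<longlonglongrightarrow> f t"
    using continuous_circle_approx[OF bdd_meas_measurable[OF f] B(2,1)] by blast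
  have bh: "bdd_meas (\<lambda>t. h n (cis t))" for n using bdd_meas_continuous_circle[OF h(1)] .
  have "(\<lambda>n. L2sq (\<lambda>t. f t - h n (cis t))) \<longlonglongrightarrow> (LINT t|circle_measure. 0)"
    unfolding L2sq_def
  proof (rule integral_dominated_convergence)
    show "AE t in circle_measure. (\<lambda>n. (norm (f t - h n (cis t)))^2) \<longlonglongrightarrow> 0"
      using h(3)
    proof eventually_elim
      case (elim t)
      then have "(\<lambda>n. (norm (f t - h n (cis t)))^2) \<longlonglongrightarrow> (norm (f t - f t))^2"
        by (intro tendsto_intros)
      then show ?case by simp
    qed
    show "AE t in circle_measure. norm ((norm (f t - h n (cis t)))^2) \<le> (B + B)^2" for n
      using B(2)
    proof eventually_elim
      case (elim t)
      have "norm (f t - h n (cis t)) \<le> B + B"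
        using norm_triangle_ineq4[of "f t" "h n (cis t)"] elim h(2)[of n "cis t"] by linarith
      from power_mono[OF this norm_ge_zero, of 2] show ?case by simp
    qed
  qed (use f bh in \<open>auto intro: bdd_meas_measurable\<close>)
  then have "(\<lambda>n. L2sq (\<lambda>t. f t - h n (cis t))) \<longlonglongrightarrow> 0" by simp
  from order_tendstoD(2)[OF this, of "e/4"] \<open>e > 0\<close>
  obtain n where n: "L2sq (\<lambda>t. f t - h n (cis t)) < e/4" by (auto simp: eventually_sequentially)
  \<comment> \<open>Chosen so that \<open>d^2\<close> integrates to \<open>e / 8\<close> over mass
    \<open>2*pi\<close>. The final bound is then below \<open>2 * (e/4) + 2 * (e/8)\<close>, which
    is less than \<open>e\<close>.\<close>
  define d where "d = sqrt (e / (16 * pi))"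
  have "d > 0" "d^2 = e / (16 * pi)" using \<open>e > 0\<close> by (auto simp: d_def)
  obtain T where T: "trig_span UNIV T" "\<And>t. norm (h n (cis t) - T t) < d"
    using trig_span_dense_continuous[OF h(1) \<open>d > 0\<close>] by blast
  have bT: "bdd_meas T" using T by auto
  have "L2sq (\<lambda>t. h n (cis t) - T t) \<le> (LINT t|circle_measure. d^2)"
    unfolding L2sq_def using bh bT T(2) by (intro integral_mono) (auto intro!: power_mono simp: less_imp_le)
  also have "\<dots> = e / 8" using \<open>d^2 = _\<close> by (simp add: measure_circle_measure)
  finally have 2: "L2sq (\<lambda>t. h n (cis t) - T t) \<le> e / 8" .
  \<comment> \<open>The parallelogram law with its midpoint term discarded; the sign in the second
    argument turns the difference into \<open>f - T\<close>.\<close>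
  have "L2sq (\<lambda>t. f t - T t) \<le> 2 * L2sq (\<lambda>t. f t - h n (cis t)) + 2 * L2sq (\<lambda>t. h n (cis t) - T t)"
    using L2sq_parallelogram[of "\<lambda>t. f t - h n (cis t)" "\<lambda>t. - (h n (cis t) - T t)"]
      L2sq_nonneg[of "\<lambda>t. ((f t - h n (cis t)) + - (h n (cis t) - T t)) / 2"] f bh bT
    by (simp add: L2sq_def norm_minus_commute)
  also have "\<dots> < e" using n 2 \<open>e > 0\<close> by simp
  finally show ?thesis using that T(1) by blast
qed

section \<open>Bounded analytic functions\<close>

text \<open>Integrating against \<open>chr n\<close> with \<open>n > 0\<close> gives, up to
  normalisation, the Fourier coefficient of index \<open>- n\<close>. So this is H-infinity in the
  angle variable.\<close>

definition hardy_inf :: "(real \<Rightarrow> complex) \<Rightarrow> bool" where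
  "hardy_inf f \<longleftrightarrow> bdd_meas f \<and> (\<forall>n>0. (LINT t|circle_measure. f t * chr n t) = 0)"

lemma Hinf_T_iff_hardy_inf: "Hinf_T f \<longleftrightarrow> hardy_inf (\<lambda>t. f (cis t))"
proof -
  have "cis (- (of_int n * t)) = chr (- n) t" for n t by (simp add: chr_def)
  moreover have "(\<forall>n::int<0. P (- n)) \<longleftrightarrow> (\<forall>n>0. P n)" for P
    by (metis minus_minus neg_0_less_iff_less)
  from this[of "\<lambda>n. (LINT t|circle_measure. f (cis t) * chr n t) = 0"] calculation show ?thesis
    unfolding Hinf_T_def hardy_inf_def Linf_T_def meas_T_def bdd_meas_def fourier_coeff_def by simp
qed

lemma hardy_inf_const: "hardy_inf (\<lambda>t. c)"
  by (simp add: hardy_inf_def integral_chr)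

lemma hardy_inf_add: "hardy_inf f \<Longrightarrow> hardy_inf g \<Longrightarrow> hardy_inf (\<lambda>t. f t + g t)"
  by (simp add: hardy_inf_def ring_distribs)

lemma integral_chr_trig_span:
  assumes "trig_span I U" "\<And>m. m \<in> I \<Longrightarrow> m + n \<noteq> 0"
  shows "(LINT t|circle_measure. U t * chr n t) = 0"
  using integral_mult_trig_span[OF assms(1), of "chr n"] assms(2)
  by (simp add: chr_mult mult.commute integral_chr)

lemma hardy_inf_analytic_approx:
  assumes f: "hardy_inf f" and "e > 0"
  obtains U where "trig_span {0..} U" "L2sq (\<lambda>t. f t - U t) < e"
proof -
  have bf: "bdd_meas f" using f by (simp add: hardy_inf_def)
  obtain T where T: "trig_span UNIV T" "L2sq (\<lambda>t. f t - T t) < e"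
    using trig_span_dense_L2[OF bf \<open>e > 0\<close>] by blast
  have "(UNIV::int set) = {0..} \<union> {..<0}" by auto
  then obtain U V where U: "trig_span {0..} U" and V: "trig_span {..<0} V" and TUV: "\<And>t. T t = U t + V t"
    using T(1) trig_span_split by metis
  have bU: "bdd_meas U" and bV: "bdd_meas V" using U V by auto
  have "(LINT t|circle_measure. (f t - U t) * cnj (- V t)) = 0"
  proof (rule integral_mult_trig_span)
    show "trig_span (uminus ` {..<0}) (\<lambda>t. cnj (- V t))"
      using trig_span_cnj[OF trig_span_cmult[OF V, of "-1"]] by simp
    show "(LINT t|circle_measure. (f t - U t) * chr n t) = 0" if "n \<in> uminus ` {..<0}" for n
    proof -
      have "n > 0" using that by auto
      then have "(LINT t|circle_measure. U t * chr n t) = 0"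
        by (intro integral_chr_trig_span[OF U]) auto
      then show ?thesis using f \<open>n > 0\<close> bU by (simp add: hardy_inf_def ring_distribs)
    qed
  qed (use bf bU in auto)
  \<comment> \<open>Pythagoras for \<open>f - T = (f - U) + (- V)\<close>: discarding the
    antianalytic part can only reduce the error.\<close>
  then have "L2sq (\<lambda>t. (f t - U t) + - V t) = L2sq (\<lambda>t. f t - U t) + L2sq (\<lambda>t. - V t)"
    using L2sq_add[of "\<lambda>t. f t - U t" "\<lambda>t. - V t"] bf bU bV by simp
  moreover have "(\<lambda>t. (f t - U t) + - V t) = (\<lambda>t. f t - T t)" by (simp add: TUV fun_eq_iff)
  ultimately have "L2sq (\<lambda>t. f t - U t) \<le> L2sq (\<lambda>t. f t - T t)"
    using L2sq_nonneg[of "\<lambda>t. - V t"] by simp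
  then show ?thesis using that U T(2) by force
qed

text \<open>An analytic polynomial \<open>U\<close> in place of \<open>f\<close> gives integral 0,
  since only positive frequencies are then tested against \<open>g\<close>. The error
  \<open>f - U\<close> is controlled by Cauchy-Schwarz.\<close>

lemma hardy_inf_mult:
  assumes f: "hardy_inf f" and g: "hardy_inf g"
  shows "hardy_inf (\<lambda>t. f t * g t)"
  unfolding hardy_inf_def
proof (intro conjI allI impI)
  have b [simp]: "bdd_meas f" "bdd_meas g" using f g by (auto simp: hardy_inf_def)
  then show "bdd_meas (\<lambda>t. f t * g t)" by simp
  fix k :: int assume "k > 0"
  define I where "I = (LINT t|circle_measure. f t * g t * chr k t)"
  \<comment> \<open>The added 1 keeps \<open>C\<close> positive, so that \<open>e^2 / C\<close> is a
    legitimate tolerance.\<close>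
  define C where "C = L2sq (\<lambda>t. g t * chr k t) + 1"
  have "C > 0" using L2sq_nonneg[of "\<lambda>t. g t * chr k t"] unfolding C_def by linarith
  have "norm I \<le> e" if "e > 0" for e
  proof -
    have "e^2 / C > 0" using that \<open>C > 0\<close> by simp
    then obtain U where U: "trig_span {0..} U" "L2sq (\<lambda>t. f t - U t) < e^2 / C"
      using hardy_inf_analytic_approx[OF f] by blast
    have [simp]: "bdd_meas U" using U by auto
    have "(LINT t|circle_measure. (g t * chr k t) * U t) = 0"
    proof (rule integral_mult_trig_span[OF U(1)])
      show "(LINT t|circle_measure. g t * chr k t * chr n t) = 0" if "n \<in> {0..}" for n
        using g that \<open>k > 0\<close> by (simp add: hardy_inf_def mult.assoc chr_mult)
    qed auto
    moreover have "I = (LINT t|circle_measure. (f t - U t) * (g t * chr k t) + (g t * chr k t) * U t)"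
      unfolding I_def by (intro Bochner_Integration.integral_cong) (auto simp: algebra_simps)
    ultimately have "I = (LINT t|circle_measure. (f t - U t) * (g t * chr k t))"
      by simp
    then have "norm I \<le> sqrt (L2sq (\<lambda>t. f t - U t) * L2sq (\<lambda>t. g t * chr k t))"
      using norm_integral_le_L2sq[of "\<lambda>t. f t - U t" "\<lambda>t. g t * chr k t"] by simp
    also have "\<dots> \<le> sqrt (e^2 / C * C)"
      using U(2) by (intro real_sqrt_le_mono mult_mono) (auto simp: C_def)
    also have "\<dots> = e" using that \<open>C > 0\<close> by simp
    finally show ?thesis .
  qed
  then have "norm I \<le> 0" by (rule field_le_epsilon[where y=0, simplified])
  then show "(LINT t|circle_measure. f t * g t * chr k t) = 0" by (simp add: I_def)
qed

text \<open>Such a \<open>g\<close> is orthogonal to every trigonometric polynomial, so no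
  approximation error in mean square can be smaller than \<open>L2sq g\<close>.\<close>

lemma fourier_zero_imp_AE_zero:
  assumes g: "bdd_meas g" and z: "\<And>n. (LINT t|circle_measure. g t * chr n t) = 0"
  shows "AE t in circle_measure. g t = 0"
proof -
  have "L2sq g \<le> e" if "e > 0" for e
  proof -
    obtain T where T: "trig_span UNIV T" "L2sq (\<lambda>t. g t - T t) < e"
      using trig_span_dense_L2[OF g \<open>e > 0\<close>] by blast
    have "trig_span (range uminus) (\<lambda>t. cnj (- T t))"
      using trig_span_cnj[OF trig_span_cmult[OF T(1), of "-1"]] by simp
    from integral_mult_trig_span[OF this g z]
    have "L2sq (\<lambda>t. g t - T t) = L2sq g + L2sq (\<lambda>t. - T t)"
      using L2sq_add[of g "\<lambda>t. - T t"] g T(1) by auto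
    then show ?thesis using T(2) L2sq_nonneg[of "\<lambda>t. - T t"] by linarith
  qed
  then have "L2sq g \<le> 0" by (rule field_le_epsilon[where y=0, simplified])
  then have "L2sq g = 0" using L2sq_nonneg[of g] by linarith
  then show ?thesis by (rule L2sq_eq_0_imp_AE[OF g])
qed

section \<open>Boundary uniqueness\<close>

text \<open>Multiples of \<open>g\<close> by analytic polynomials with constant coefficient 1. This
  set is convex, as the midpoint argument needs, and admits the variations
  \<open>q + c z^k q\<close> with \<open>k >= 1\<close>.\<close>

definition unit_multiples :: "(real \<Rightarrow> complex) \<Rightarrow> (real \<Rightarrow> complex) set" where
  "unit_multiples g = {q. \<exists>V. trig_span {1..} V \<and> q = (\<lambda>t. g t * (1 + V t))}"

lemma unit_multiplesI:
  "trig_span {1..} V \<Longrightarrow> (\<And>t. q t = g t * (1 + V t)) \<Longrightarrow> q \<in> unit_multiples g"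
  unfolding unit_multiples_def by blast

lemma unit_multiples_self: "g \<in> unit_multiples g"
  by (rule unit_multiplesI[OF trig_span_0]) simp

lemma unit_multiples_bdd_meas: "bdd_meas g \<Longrightarrow> q \<in> unit_multiples g \<Longrightarrow> bdd_meas q"
  unfolding unit_multiples_def by auto

lemma unit_multiples_zero: "q \<in> unit_multiples g \<Longrightarrow> g t = 0 \<Longrightarrow> q t = 0"
  unfolding unit_multiples_def by auto

lemma unit_multiples_average:
  assumes "p \<in> unit_multiples g" "q \<in> unit_multiples g"
  shows "(\<lambda>t. (p t + q t) / 2) \<in> unit_multiples g"
proof -
  obtain U V where U: "trig_span {1..} U" "p = (\<lambda>t. g t * (1 + U t))"
    and V: "trig_span {1..} V" "q = (\<lambda>t. g t * (1 + V t))"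
    using assms unfolding unit_multiples_def by blast
  show ?thesis
    by (rule unit_multiplesI[OF trig_span_cmult[OF trig_span_add[OF U(1) V(1)], of "1/2"]])
      (simp add: U V field_simps)
qed

lemma unit_multiples_shift:
  assumes "q \<in> unit_multiples g" "k \<ge> 1"
  shows "(\<lambda>t. q t + c * chr k t * q t) \<in> unit_multiples g"
proof -
  obtain V where V: "trig_span {1..} V" "q = (\<lambda>t. g t * (1 + V t))"
    using assms unfolding unit_multiples_def by blast
  have c: "trig_span {1..} (\<lambda>t. c * chr k t)" using assms by (intro trig_span_chr) auto
  show ?thesis
    by (rule unit_multiplesI[OF trig_span_add[OF trig_span_add[OF V(1) c] trig_span_mult[OF c V(1), of "{1..}"]]])
      (auto simp: V(2) algebra_simps)
qed

text \<open>The norm of the competitor \<open>q + c z^j q\<close> is a quadratic function of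
  \<open>c\<close>. Its minimum is still at least \<open>d\<close>, which bounds the linear
  coefficient, a Fourier coefficient of the squared modulus of \<open>q\<close>.\<close>

lemma unit_multiples_near_orthogonal:
  assumes g: "bdd_meas g" and q: "q \<in> unit_multiples g" and "d > 0"
    and d: "\<And>p. p \<in> unit_multiples g \<Longrightarrow> d \<le> L2sq p" and "k \<noteq> 0"
  shows "(norm (LINT t|circle_measure. of_real ((norm (q t))^2) * chr k t))^2 \<le> L2sq q * (L2sq q - d)"
proof -
  have bq [simp]: "bdd_meas q" using unit_multiples_bdd_meas[OF g q] .
  define L where "L = L2sq q"
  have "L > 0" using d[OF q] \<open>d > 0\<close> by (simp add: L_def)
  have *: "(norm (LINT t|circle_measure. of_real ((norm (q t))^2) * chr (- j) t))^2 \<le> L * (L - d)" if "j \<ge> 1" for j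
  proof -
    define \<alpha> where "\<alpha> = (LINT t|circle_measure. of_real ((norm (q t))^2) * chr (- j) t)"
    \<comment> \<open>The minimiser of the quadratic; the minimum is
      \<open>L - (norm \<alpha>)^2 / L\<close>.\<close>
    define c where "c = - \<alpha> / of_real L"
    have "d \<le> L2sq (\<lambda>t. q t + c * chr j t * q t)"
      by (rule d[OF unit_multiples_shift[OF q that]])
    also have "\<dots> = L + L2sq (\<lambda>t. c * chr j t * q t) + 2 * Re (LINT t|circle_measure. q t * cnj (c * chr j t * q t))"
      unfolding L_def by (rule L2sq_add) auto
    also have "L2sq (\<lambda>t. c * chr j t * q t) = (norm c)^2 * L"
      by (simp add: L_def L2sq_def norm_mult power_mult_distrib)
    also have "(LINT t|circle_measure. q t * cnj (c * chr j t * q t)) =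
        (LINT t|circle_measure. cnj c * (of_real ((norm (q t))^2) * chr (- j) t))"
      by (intro Bochner_Integration.integral_cong) (auto simp: complex_norm_square mult_ac simp del: of_real_power)
    also have "\<dots> = cnj c * \<alpha>" unfolding \<alpha>_def by (rule integral_mult_right_zero)
    also have "cnj c * \<alpha> = - of_real ((norm \<alpha>)^2 / L)"
      unfolding c_def by (simp add: complex_norm_square mult.commute del: of_real_power)
    finally have "d \<le> L + (norm \<alpha>)^2 / L^2 * L - 2 * ((norm \<alpha>)^2 / L)"
      by (simp add: c_def norm_divide power_divide)
    also have "\<dots> = L - (norm \<alpha>)^2 / L" using \<open>L > 0\<close> by (simp add: power2_eq_square field_simps)
    finally have "(norm \<alpha>)^2 \<le> L * (L - d)" using \<open>L > 0\<close> by (simp add: field_simps)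
    then show ?thesis unfolding \<alpha>_def .
  qed
  show ?thesis
  proof (cases "k > 0")
    case False
    then show ?thesis using *[of "- k"] \<open>k \<noteq> 0\<close> by (simp add: L_def)
  next
    case True
    \<comment> \<open>The squared modulus is real, so coefficients of opposite index are conjugate
      and the bound for \<open>- k\<close> also serves \<open>k\<close>.\<close>
    have "(LINT t|circle_measure. of_real ((norm (q t))^2) * chr (- k) t) =
        (LINT t|circle_measure. cnj (of_real ((norm (q t))^2) * chr k t))"
      by simp
    also have "\<dots> = cnj (LINT t|circle_measure. of_real ((norm (q t))^2) * chr k t)"
      by (rule Bochner_Integration.integral_cnj)
    finally have "norm (LINT t|circle_measure. of_real ((norm (q t))^2) * chr (- k) t) =
        norm (LINT t|circle_measure. of_real ((norm (q t))^2) * chr k t)"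
      by (simp only: complex_mod_cnj)
    then show ?thesis using *[of k] True by (simp add: L_def)
  qed
qed

text \<open>The measures with density \<open>(norm (q n t))^2\<close> converge weakly to a constant
  density of mass \<open>d\<close>. Characters are handled by
  \<open>unit_multiples_near_orthogonal\<close>, trigonometric polynomials by linearity, and
  continuous functions by uniform approximation, as the masses stay bounded.\<close>

lemma minimising_sequence_weak_limit:
  fixes h :: "complex \<Rightarrow> real"
  assumes g: "bdd_meas g" and q: "\<And>n. q n \<in> unit_multiples g" and "d > 0"
    and d: "\<And>p. p \<in> unit_multiples g \<Longrightarrow> d \<le> L2sq p"
    and lim: "(\<lambda>n. L2sq (q n)) \<longlonglongrightarrow> d"
    and h: "continuous_on (sphere 0 1) h"
  shows "(\<lambda>n. LINT t|circle_measure. (norm (q n t))^2 * h (cis t)) \<longlonglongrightarrow>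
    d / (2 * pi) * (LINT t|circle_measure. h (cis t))"
proof -
  have bq [simp]: "bdd_meas (q n)" for n using unit_multiples_bdd_meas[OF g q] .
  define W where "W n u = (LINT t|circle_measure. complex_of_real ((norm (q n t))^2) * u t)" for n u
  define D where "D = d / (2 * pi)"
  have "D > 0" using \<open>d > 0\<close> by (simp add: D_def)
  define J :: "(real \<Rightarrow> complex) \<Rightarrow> complex" where "J u = (LINT t|circle_measure. u t)" for u
  have chr: "(\<lambda>n. W n (chr k)) \<longlonglongrightarrow> of_real D * J (chr k)" for k
  proof (cases "k = 0")
    case True
    have "W n (chr 0) = of_real (L2sq (q n))" for n
      unfolding W_def L2sq_def by (simp del: of_real_power)
    moreover have "of_real D * J (chr 0) = of_real d"
      by (simp add: J_def integral_chr[of 0, simplified] D_def)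
    ultimately show ?thesis using lim True by (simp only: tendsto_of_real_iff)
  next
    case False
    have "(\<lambda>n. (norm (W n (chr k)))^2) \<longlonglongrightarrow> 0"
    proof (rule Lim_null_comparison)
      show "\<forall>\<^sub>F n in sequentially. norm ((norm (W n (chr k)))^2) \<le> L2sq (q n) * (L2sq (q n) - d)"
        using unit_multiples_near_orthogonal[OF g q \<open>d > 0\<close> d False] by (simp add: W_def)
      have "(\<lambda>n. L2sq (q n) * (L2sq (q n) - d)) \<longlonglongrightarrow> d * (d - d)"
        using lim by (intro tendsto_intros)
      then show "(\<lambda>n. L2sq (q n) * (L2sq (q n) - d)) \<longlonglongrightarrow> 0" by simp
    qed
    from tendsto_real_sqrt[OF this] have "(\<lambda>n. norm (W n (chr k))) \<longlonglongrightarrow> 0" by simp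
    then have "(\<lambda>n. W n (chr k)) \<longlonglongrightarrow> 0" by (rule tendsto_norm_zero_cancel)
    then show ?thesis using False by (simp add: J_def integral_chr)
  qed
  have trig: "(\<lambda>n. W n T) \<longlonglongrightarrow> of_real D * J T" if "trig_span UNIV T" for T
    using that
  proof induction
    case trig_span_0
    show ?case by (simp add: W_def J_def)
  next
    case (trig_span_step T k c)
    have bT [simp]: "bdd_meas T" using trig_span_step.hyps by auto
    have "W n (\<lambda>t. T t + c * chr k t) = W n T + c * W n (chr k)" for n
    proof -
      have "W n (\<lambda>t. T t + c * chr k t) = (LINT t|circle_measure. complex_of_real ((norm (q n t))^2) * T t
          + c * (complex_of_real ((norm (q n t))^2) * chr k t))"
        unfolding W_def by (intro Bochner_Integration.integral_cong) (auto simp: algebra_simps)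
      also have "\<dots> = W n T + c * W n (chr k)"
        unfolding W_def by (subst Bochner_Integration.integral_add) (auto simp del: of_real_power)
      finally show ?thesis .
    qed
    moreover have "J (\<lambda>t. T t + c * chr k t) = J T + c * J (chr k)"
      by (simp add: J_def)
    moreover have "(\<lambda>n. W n T + c * W n (chr k)) \<longlonglongrightarrow> of_real D * J T + c * (of_real D * J (chr k))"
      by (intro tendsto_intros trig_span_step.IH chr)
    ultimately show ?case by (simp add: algebra_simps)
  qed
  define u where "u t = complex_of_real (h (cis t))" for t
  have bh [simp]: "bdd_meas (\<lambda>t. h (cis t))" using bdd_meas_continuous_circle[OF h] .
  have bu [simp]: "bdd_meas u" unfolding u_def by simp
  have "(\<lambda>n. W n u) \<longlonglongrightarrow> of_real D * J u"
  proof (rule LIMSEQ_I)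
    fix e :: real assume "e > 0"
    \<comment> \<open>With eventual mass below \<open>d + 1\<close>, replacing \<open>u\<close> by
      \<open>T\<close> costs at most \<open>e / 3\<close> both along the sequence and in the limit;
      the convergence for \<open>T\<close> takes the last third.\<close>
    define r where "r = e / (3 * (d + 1))"
    have "r > 0" "r * (d + 1) = e / 3" using \<open>e > 0\<close> \<open>d > 0\<close> by (auto simp: r_def field_simps)
    have "continuous_on (sphere 0 1) (\<lambda>z. complex_of_real (h z))" using h by (intro continuous_intros)
    from trig_span_dense_continuous[OF this \<open>r > 0\<close>]
    obtain T where T: "trig_span UNIV T" "\<And>t. norm (u t - T t) < r"
      unfolding u_def by blast
    have bT [simp]: "bdd_meas T" using T by auto
    have W: "norm (W n u - W n T) \<le> r * L2sq (q n)" for n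
    proof -
      have "W n u - W n T = (LINT t|circle_measure. complex_of_real ((norm (q n t))^2) * (u t - T t))"
        unfolding W_def right_diff_distrib by (subst Bochner_Integration.integral_diff) (auto simp del: of_real_power)
      then have "norm (W n u - W n T) \<le> (LINT t|circle_measure. norm (complex_of_real ((norm (q n t))^2) * (u t - T t)))"
        by (simp only: integral_norm_bound)
      also have "\<dots> \<le> (LINT t|circle_measure. r * (norm (q n t))^2)"
      proof (rule integral_mono)
        show "norm (complex_of_real ((norm (q n t))^2) * (u t - T t)) \<le> r * (norm (q n t))^2" for t
          using mult_left_mono[OF less_imp_le[OF T(2)[of t]], of "(norm (q n t))^2"]
          by (simp add: norm_mult norm_power mult.commute)
      qed (auto simp del: of_real_power)
      also have "\<dots> = r * L2sq (q n)" unfolding L2sq_def by simp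
      finally show ?thesis .
    qed
    have Jd: "norm (of_real D * J T - of_real D * J u) \<le> r * d"
    proof -
      have "J T - J u = (LINT t|circle_measure. T t - u t)" by (simp add: J_def)
      then have "norm (J T - J u) \<le> (LINT t|circle_measure. norm (T t - u t))"
        by (simp only: integral_norm_bound)
      also have "\<dots> \<le> (LINT t|circle_measure. r)"
        using T(2) by (intro integral_mono) (auto simp: norm_minus_commute less_imp_le)
      also have "\<dots> = r * (2 * pi)" by (simp add: measure_circle_measure)
      finally have "D * norm (J T - J u) \<le> D * (r * (2 * pi))" using \<open>D > 0\<close> by (intro mult_left_mono) auto
      also have "\<dots> = r * d" by (simp add: D_def)
      finally show ?thesis using \<open>D > 0\<close> by (simp add: right_diff_distrib[symmetric] norm_mult)
    qed
    have "\<forall>\<^sub>F n in sequentially. norm (W n T - of_real D * J T) < e / 3"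
      using tendstoD[OF trig[OF T(1)], of "e/3"] \<open>e > 0\<close> by (simp add: dist_norm)
    moreover have "\<forall>\<^sub>F n in sequentially. L2sq (q n) < d + 1"
      using order_tendstoD(2)[OF lim, of "d + 1"] by simp
    ultimately have "\<forall>\<^sub>F n in sequentially. norm (W n u - of_real D * J u) < e"
    proof eventually_elim
      case (elim n)
      have "r * L2sq (q n) \<le> e / 3"
        using elim \<open>r > 0\<close> mult_left_mono[of "L2sq (q n)" "d + 1" r] \<open>r * (d + 1) = e / 3\<close> by simp
      moreover have "r * d \<le> e / 3"
        using \<open>r > 0\<close> \<open>r * (d + 1) = e / 3\<close> by (simp add: ring_distribs)
      moreover have "norm (W n u - of_real D * J u) \<le>
          norm (W n u - W n T) + norm (W n T - of_real D * J T) + norm (of_real D * J T - of_real D * J u)"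
        by (rule norm_diff_triangle_le[OF norm_diff_triangle_le[OF order_refl order_refl] order_refl])
      ultimately show ?case using W[of n] Jd elim by linarith
    qed
    then show "\<exists>n0. \<forall>n\<ge>n0. norm (W n u - of_real D * J u) < e"
      by (simp add: eventually_sequentially)
  qed
  moreover have "W n u = of_real (LINT t|circle_measure. (norm (q n t))^2 * h (cis t))" for n
    unfolding W_def u_def of_real_mult[symmetric] by (rule integral_complex_of_real)
  moreover have "of_real D * J u = of_real (D * (LINT t|circle_measure. h (cis t)))"
    unfolding J_def u_def by simp
  ultimately show ?thesis by (simp only: tendsto_of_real_iff D_def)
qed

text \<open>The midpoint of \<open>p\<close> and \<open>q\<close> is again a competitor, so the
  parallelogram law makes \<open>p - q\<close> small. Factoring the difference of squares and
  Cauchy-Schwarz pass this on to the squared moduli.\<close>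

lemma unit_multiples_L1_close:
  assumes g: "bdd_meas g" and p: "p \<in> unit_multiples g" and q: "q \<in> unit_multiples g"
    and d: "\<And>p. p \<in> unit_multiples g \<Longrightarrow> d \<le> L2sq p"
    and e: "L2sq p \<le> d + e" "L2sq q \<le> d + e"
  shows "(LINT t|circle_measure. \<bar>(norm (p t))^2 - (norm (q t))^2\<bar>) \<le> 2 * sqrt (4 * e * (d + e))"
proof -
  have [simp]: "bdd_meas p" "bdd_meas q" using unit_multiples_bdd_meas[OF g] p q by auto
  have "L2sq (\<lambda>t. p t - q t) \<le> 4 * e"
    using L2sq_parallelogram[of p q] d[OF unit_multiples_average[OF p q]] e by simp
  moreover from this have "e \<ge> 0" using L2sq_nonneg[of "\<lambda>t. p t - q t"] by linarith
  ultimately have CS: "(LINT t|circle_measure. norm (p t - q t) * norm (w t)) \<le> sqrt (4 * e * (d + e))"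
    if "bdd_meas w" "L2sq w \<le> d + e" for w
    using that by (intro order_trans[OF Cauchy_Schwarz_circle] real_sqrt_le_mono mult_mono)
      (auto intro: order_trans[OF L2sq_nonneg])
  have "(LINT t|circle_measure. \<bar>(norm (p t))^2 - (norm (q t))^2\<bar>) \<le>
      (LINT t|circle_measure. norm (p t - q t) * norm (p t) + norm (p t - q t) * norm (q t))"
  proof (rule integral_mono)
    fix t
    have "\<bar>(norm (p t))^2 - (norm (q t))^2\<bar> = \<bar>norm (p t) - norm (q t)\<bar> * (norm (p t) + norm (q t))"
      by (simp add: power2_eq_square square_diff_square_factored abs_mult)
    also have "\<dots> \<le> norm (p t - q t) * (norm (p t) + norm (q t))"
      by (intro mult_right_mono norm_triangle_ineq3) auto
    finally show "\<bar>(norm (p t))^2 - (norm (q t))^2\<bar> \<le> norm (p t - q t) * norm (p t) + norm (p t - q t) * norm (q t)"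
      by (simp add: ring_distribs)
  qed auto
  also have "\<dots> = (LINT t|circle_measure. norm (p t - q t) * norm (p t)) + (LINT t|circle_measure. norm (p t - q t) * norm (q t))"
    by simp
  also have "\<dots> \<le> 2 * sqrt (4 * e * (d + e))"
    using CS[of p] CS[of q] e by simp
  finally show ?thesis .
qed

text \<open>Weak convergence tests only continuous functions, while the zero set of \<open>g\<close>
  is merely measurable. The \<open>L^1\<close> Cauchy estimate bridges this gap.\<close>

lemma unit_multiples_small:
  assumes g: "bdd_meas g" and nz: "\<not> (AE t in circle_measure. g t \<noteq> 0)" and "e > 0"
  obtains q where "q \<in> unit_multiples g" "L2sq q < e"
proof (rule ccontr)
  assume "\<not> thesis"
  then have ge: "e \<le> L2sq q" if "q \<in> unit_multiples g" for q
    using that \<open>\<And>q. q \<in> unit_multiples g \<Longrightarrow> L2sq q < e \<Longrightarrow> thesis\<close> by force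
  define d where "d = (INF q\<in>unit_multiples g. L2sq q)"
  have "d \<ge> e" unfolding d_def using ge unit_multiples_self by (intro cINF_greatest) auto
  then have "d > 0" using \<open>e > 0\<close> by simp
  have d: "d \<le> L2sq p" if "p \<in> unit_multiples g" for p
    unfolding d_def using that ge by (intro cINF_lower bdd_belowI2[of _ e]) auto
  have "\<exists>q\<in>unit_multiples g. L2sq q < d + inverse (real (Suc n))" for n
  proof -
    have "d < d + inverse (real (Suc n))" by simp
    then show ?thesis
      unfolding d_def using ge unit_multiples_self by (subst (asm) cINF_less_iff) (auto intro!: bdd_belowI2[of _ e])
  qed
  then obtain q where q: "\<And>n. q n \<in> unit_multiples g" and qd: "\<And>n. L2sq (q n) < d + inverse (real (Suc n))"
    by metis
  have [simp]: "bdd_meas (q n)" for n using unit_multiples_bdd_meas[OF g q] .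
  have lim: "(\<lambda>n. L2sq (q n)) \<longlonglongrightarrow> d"
  proof (rule tendsto_sandwich[OF _ _ tendsto_const])
    show "(\<lambda>n. d + inverse (real (Suc n))) \<longlonglongrightarrow> d"
      using tendsto_add[OF tendsto_const LIMSEQ_inverse_real_of_nat, of d] by simp
  qed (use d[OF q] less_imp_le[OF qd] in \<open>auto intro!: always_eventually\<close>)
  define D where "D = d / (2 * pi)"
  have "D > 0" using \<open>d > 0\<close> by (simp add: D_def)
  define \<eta> where "\<eta> n = 2 * sqrt (4 * inverse (real (Suc n)) * (d + inverse (real (Suc n))))" for n
  have cauchy: "(LINT t|circle_measure. \<bar>(norm (q m t))^2 - (norm (q n t))^2\<bar>) \<le> \<eta> n" if "m \<ge> n" for m n
    unfolding \<eta>_def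
  proof (rule unit_multiples_L1_close[OF g q q d])
    have "inverse (real (Suc m)) \<le> inverse (real (Suc n))" using that by (simp add: field_simps)
    then show "L2sq (q m) \<le> d + inverse (real (Suc n))" using qd[of m] by linarith
  qed (use qd[of n] in auto)
  \<comment> \<open>The indicator of the zero set of \<open>g\<close>, complex valued to fit
    \<open>continuous_circle_approx\<close>. Taking norms of the approximants gives real weights
    between 0 and 1.\<close>
  define f where "f t = (if g t = 0 then 1 else 0 :: complex)" for t
  have f: "f \<in> borel_measurable circle_measure"
    using bdd_meas_measurable[OF g] unfolding f_def by measurable
  have "AE t in circle_measure. norm (f t) \<le> 1" by (simp add: f_def)
  from continuous_circle_approx[OF f this]
  obtain h where h: "\<And>n. continuous_on (sphere 0 1) (h n)" "\<And>n z. norm (h n z) \<le> 1"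
      "AE t in circle_measure. (\<lambda>n. h n (cis t)) \<longlonglongrightarrow> f t"
    by auto
  have hc: "continuous_on (sphere 0 1) (\<lambda>z. norm (h j z))" for j using h(1) by (intro continuous_intros)
  have bh [simp]: "bdd_meas (\<lambda>t. norm (h j (cis t)))" for j using bdd_meas_continuous_circle[OF hc] .
  have bf [simp]: "bdd_meas (\<lambda>t. norm (f t))"
    using f by (intro bdd_meas_norm bdd_measI[of f 1]) (auto simp: f_def)
  \<comment> \<open>The order of limits matters: first \<open>m\<close> tends to infinity with
    \<open>n\<close> and the continuous weight fixed, at a cost \<open>\<eta> n\<close> independent
    of \<open>j\<close>; then \<open>j\<close> does in \<open>step2\<close>, and finally
    \<open>n\<close>.\<close>
  have step1: "D * (LINT t|circle_measure. norm (h j (cis t))) \<le>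
      (LINT t|circle_measure. (norm (q n t))^2 * norm (h j (cis t))) + \<eta> n" for j n
  proof (rule LIMSEQ_le_const2)
    show "(\<lambda>m. LINT t|circle_measure. (norm (q m t))^2 * norm (h j (cis t)))
        \<longlonglongrightarrow> D * (LINT t|circle_measure. norm (h j (cis t)))"
      unfolding D_def by (rule minimising_sequence_weak_limit[OF g q \<open>d > 0\<close> d lim hc])
    show "\<exists>N. \<forall>m\<ge>N. (LINT t|circle_measure. (norm (q m t))^2 * norm (h j (cis t))) \<le>
        (LINT t|circle_measure. (norm (q n t))^2 * norm (h j (cis t))) + \<eta> n"
    proof (intro exI[of _ n] allI impI)
      fix m assume "n \<le> m"
      have "(LINT t|circle_measure. (norm (q m t))^2 * norm (h j (cis t))) \<le>
          (LINT t|circle_measure. (norm (q n t))^2 * norm (h j (cis t)) + \<bar>(norm (q m t))^2 - (norm (q n t))^2\<bar>)"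
      proof (rule integral_mono)
        fix t
        have "((norm (q m t))^2 - (norm (q n t))^2) * norm (h j (cis t)) \<le> \<bar>(norm (q m t))^2 - (norm (q n t))^2\<bar> * 1"
          using h(2)[of j "cis t"] by (intro mult_mono) auto
        then show "(norm (q m t))^2 * norm (h j (cis t)) \<le>
            (norm (q n t))^2 * norm (h j (cis t)) + \<bar>(norm (q m t))^2 - (norm (q n t))^2\<bar>"
          by (simp add: algebra_simps)
      qed auto
      also have "\<dots> = (LINT t|circle_measure. (norm (q n t))^2 * norm (h j (cis t))) +
          (LINT t|circle_measure. \<bar>(norm (q m t))^2 - (norm (q n t))^2\<bar>)"
        by simp
      finally show "(LINT t|circle_measure. (norm (q m t))^2 * norm (h j (cis t))) \<le>
          (LINT t|circle_measure. (norm (q n t))^2 * norm (h j (cis t))) + \<eta> n"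
        using cauchy[OF \<open>n \<le> m\<close>] by linarith
    qed
  qed
  have dom: "(\<lambda>j. LINT t|circle_measure. w t * norm (h j (cis t))) \<longlonglongrightarrow> (LINT t|circle_measure. w t * norm (f t))"
    if w [simp]: "bdd_meas w" for w :: "real \<Rightarrow> real"
  proof (rule integral_dominated_convergence[where w="\<lambda>t. \<bar>w t\<bar>"])
    show "AE t in circle_measure. (\<lambda>j. w t * norm (h j (cis t))) \<longlonglongrightarrow> w t * norm (f t)"
      using h(3) by eventually_elim (intro tendsto_intros)
    show "AE t in circle_measure. norm (w t * norm (h j (cis t))) \<le> \<bar>w t\<bar>" for j
      using h(2) by (intro AE_I2) (simp add: abs_mult mult_left_le)
  qed (auto intro!: bdd_meas_measurable)
  have step2: "D * (LINT t|circle_measure. norm (f t)) \<le> \<eta> n" for n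
  proof -
    have "D * (LINT t|circle_measure. 1 * norm (f t)) \<le> (LINT t|circle_measure. (norm (q n t))^2 * norm (f t)) + \<eta> n"
      using step1 by (intro LIMSEQ_le[OF tendsto_mult[OF tendsto_const dom] tendsto_add[OF dom tendsto_const]]) auto
    \<comment> \<open>Every multiple of \<open>g\<close> vanishes where \<open>g\<close> does, so
      only \<open>\<eta> n\<close> remains on the right.\<close>
    moreover have "(norm (q n t))^2 * norm (f t) = 0" for t
      using unit_multiples_zero[OF q, of t n] by (simp add: f_def)
    ultimately show ?thesis by simp
  qed
  have "\<eta> \<longlonglongrightarrow> 2 * sqrt (4 * 0 * (d + 0))"
    unfolding \<eta>_def [abs_def] by (intro tendsto_intros LIMSEQ_inverse_real_of_nat)
  then have "D * (LINT t|circle_measure. norm (f t)) \<le> 0"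
    using step2 by (intro LIMSEQ_le_const[of \<eta>]) auto
  then have "(LINT t|circle_measure. norm (f t)) \<le> 0"
    using \<open>D > 0\<close> by (simp add: mult_le_0_iff)
  moreover have "(LINT t|circle_measure. norm (f t)) \<ge> 0" by (intro integral_nonneg_AE) auto
  ultimately have "(LINT t|circle_measure. norm (f t)) = 0" by linarith
  then have "AE t in circle_measure. norm (f t) = 0"
    by (subst (asm) integral_nonneg_eq_0_iff_AE) auto
  then have "AE t in circle_measure. g t \<noteq> 0"
    by eventually_elim (auto simp: f_def split: if_splits)
  with nz show False ..
qed

text \<open>By induction on the index, all earlier coefficients of \<open>g\<close> vanish, so the
  next one is the same for \<open>g\<close> and for each of its unit multiples. Those have
  arbitrarily small norm.\<close>

theorem hardy_inf_boundary_uniqueness: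
  assumes g: "hardy_inf g" and nz: "\<not> (AE t in circle_measure. g t \<noteq> 0)"
  shows "AE t in circle_measure. g t = 0"
proof (rule fourier_zero_imp_AE_zero)
  show bg [simp]: "bdd_meas g" using g by (simp add: hardy_inf_def)
  have pos: "(LINT t|circle_measure. g t * chr n t) = 0" if "n > 0" for n
    using g that by (simp add: hardy_inf_def)
  have neg: "(LINT t|circle_measure. g t * chr (- int N) t) = 0" for N
  proof (induction N rule: less_induct)
    case (less N)
    \<comment> \<open>A factor \<open>chr n\<close> with \<open>n >= 1\<close> lowers the
      coefficient index to \<open>N - n\<close>, which is either negative or covered by the
      induction hypothesis.\<close>
    have shift: "(LINT t|circle_measure. g t * chr (- int N) t * chr n t) = 0" if "n \<in> {1..}" for n
    proof (cases "n > int N")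
      case True
      then show ?thesis using pos by (simp add: mult.assoc chr_mult)
    next
      case False
      then have "nat (int N - n) < N" "- int N + n = - int (nat (int N - n))" using that by auto
      then show ?thesis using less.IH by (simp only: mult.assoc chr_mult)
    qed
    have "norm (LINT t|circle_measure. g t * chr (- int N) t) \<le> e" if "e > 0" for e
    proof -
      \<comment> \<open>The divisor \<open>2 * pi\<close> offsets the squared norm of a character in
        Cauchy-Schwarz.\<close>
      have "e^2 / (2 * pi) > 0" using that by simp
      then obtain q where q: "q \<in> unit_multiples g" "L2sq q < e^2 / (2 * pi)"
        using unit_multiples_small[OF bg nz] by blast
      then obtain V where V: "trig_span {1..} V" "q = (\<lambda>t. g t * (1 + V t))"
        unfolding unit_multiples_def by blast
      have [simp]: "bdd_meas V" "bdd_meas q" using V q unit_multiples_bdd_meas[OF bg] by auto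
      have "(LINT t|circle_measure. q t * chr (- int N) t) =
          (LINT t|circle_measure. g t * chr (- int N) t + g t * chr (- int N) t * V t)"
        by (intro Bochner_Integration.integral_cong) (auto simp: V(2) algebra_simps)
      also have "\<dots> = (LINT t|circle_measure. g t * chr (- int N) t)"
        using integral_mult_trig_span[OF V(1) _ shift] by simp
      finally have "norm (LINT t|circle_measure. g t * chr (- int N) t) \<le> sqrt (L2sq q * L2sq (chr (- int N)))"
        using norm_integral_le_L2sq[of q "chr (- int N)"] by simp
      also have "L2sq (chr (- int N)) = 2 * pi"
        by (simp add: L2sq_def measure_circle_measure)
      also have "sqrt (L2sq q * (2 * pi)) \<le> sqrt (e^2)"
        using q(2) by (intro real_sqrt_le_mono) (simp add: field_simps)
      finally show ?thesis using that by simp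
    qed
    then have "norm (LINT t|circle_measure. g t * chr (- int N) t) \<le> 0"
      by (rule field_le_epsilon[where y=0, simplified])
    then show ?case by simp
  qed
  show "(LINT t|circle_measure. g t * chr n t) = 0" for n
    using pos[of n] neg[of "nat (- n)"] by (cases "n > 0") auto
qed

section \<open>The Nevanlinna class is a field\<close>

lemma Hinf_T_const: "Hinf_T (\<lambda>z. c)"
  by (simp add: Hinf_T_iff_hardy_inf hardy_inf_const)

lemma Hinf_T_add: "Hinf_T f \<Longrightarrow> Hinf_T g \<Longrightarrow> Hinf_T (\<lambda>z. f z + g z)"
  by (simp add: Hinf_T_iff_hardy_inf hardy_inf_add)

lemma Hinf_T_mult: "Hinf_T f \<Longrightarrow> Hinf_T g \<Longrightarrow> Hinf_T (\<lambda>z. f z * g z)"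
  by (simp add: Hinf_T_iff_hardy_inf hardy_inf_mult)

lemma not_AE_circle_False: "\<not> (AE t in circle_measure. False)"
  using ae_filter_eq_bot_iff[of circle_measure] emeasure_circle_measure
  by (simp add: trivial_limit_def)

lemma NevI:
  assumes "Hinf_T h" "Hinf_T g" "AE t in circle_measure. g (cis t) \<noteq> 0"
    "AE t in circle_measure. f (cis t) = h (cis t) / g (cis t)"
  shows "Nev f"
proof -
  have "\<not> (AE t in circle_measure. g (cis t) = 0)"
  proof
    assume "AE t in circle_measure. g (cis t) = 0"
    with assms(3) have "AE t in circle_measure. False" by eventually_elim simp
    then show False using not_AE_circle_False by blast
  qed
  then show ?thesis unfolding Nev_def using assms by blast
qed

text \<open>Boundary uniqueness upgrades a denominator that is not the zero function to one nonzero
  almost everywhere, so fractions can be manipulated pointwise.\<close>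

lemma NevE:
  assumes "Nev f"
  obtains h g where "Hinf_T h" "Hinf_T g" "AE t in circle_measure. g (cis t) \<noteq> 0"
    "AE t in circle_measure. f (cis t) = h (cis t) / g (cis t)"
proof -
  obtain h g where hg: "Hinf_T h" "Hinf_T g" "\<not> (AE t in circle_measure. g (cis t) = 0)"
      "AE t in circle_measure. f (cis t) = h (cis t) / g (cis t)"
    using assms unfolding Nev_def by blast
  then have "AE t in circle_measure. g (cis t) \<noteq> 0"
    using hardy_inf_boundary_uniqueness unfolding Hinf_T_iff_hardy_inf by blast
  with hg show thesis using that by blast
qed

lemma Nev_cong_AE:
  assumes "Nev f" "AE t in circle_measure. f' (cis t) = f (cis t)"
  shows "Nev f'"
proof -
  from assms(1) obtain h g where hg: "Hinf_T h" "Hinf_T g" "AE t in circle_measure. g (cis t) \<noteq> 0"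
    "AE t in circle_measure. f (cis t) = h (cis t) / g (cis t)" by (rule NevE)
  from assms(2) hg(4) have "AE t in circle_measure. f' (cis t) = h (cis t) / g (cis t)"
    by eventually_elim simp
  with hg(1-3) show ?thesis by (rule NevI)
qed

lemma Nev_const: "Nev (\<lambda>z. c)"
  by (rule NevI[OF Hinf_T_const[of c] Hinf_T_const[of 1]]) auto

lemma Nev_add:
  assumes "Nev f1" "Nev f2" shows "Nev (\<lambda>z. f1 z + f2 z)"
proof -
  from assms(1) obtain h1 g1 where 1: "Hinf_T h1" "Hinf_T g1" "AE t in circle_measure. g1 (cis t) \<noteq> 0"
    "AE t in circle_measure. f1 (cis t) = h1 (cis t) / g1 (cis t)" by (rule NevE)
  from assms(2) obtain h2 g2 where 2: "Hinf_T h2" "Hinf_T g2" "AE t in circle_measure. g2 (cis t) \<noteq> 0"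
    "AE t in circle_measure. f2 (cis t) = h2 (cis t) / g2 (cis t)" by (rule NevE)
  show ?thesis
  proof (rule NevI)
    show "Hinf_T (\<lambda>z. h1 z * g2 z + h2 z * g1 z)" "Hinf_T (\<lambda>z. g1 z * g2 z)"
      using 1 2 by (auto intro: Hinf_T_add Hinf_T_mult)
    show "AE t in circle_measure. g1 (cis t) * g2 (cis t) \<noteq> 0"
      using 1(3) 2(3) by eventually_elim simp
    show "AE t in circle_measure. f1 (cis t) + f2 (cis t) =
        (h1 (cis t) * g2 (cis t) + h2 (cis t) * g1 (cis t)) / (g1 (cis t) * g2 (cis t))"
      using 1(3,4) 2(3,4) by eventually_elim (simp add: add_frac_eq)
  qed
qed

lemma Nev_mult:
  assumes "Nev f1" "Nev f2" shows "Nev (\<lambda>z. f1 z * f2 z)"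
proof -
  from assms(1) obtain h1 g1 where 1: "Hinf_T h1" "Hinf_T g1" "AE t in circle_measure. g1 (cis t) \<noteq> 0"
    "AE t in circle_measure. f1 (cis t) = h1 (cis t) / g1 (cis t)" by (rule NevE)
  from assms(2) obtain h2 g2 where 2: "Hinf_T h2" "Hinf_T g2" "AE t in circle_measure. g2 (cis t) \<noteq> 0"
    "AE t in circle_measure. f2 (cis t) = h2 (cis t) / g2 (cis t)" by (rule NevE)
  show ?thesis
  proof (rule NevI)
    show "Hinf_T (\<lambda>z. h1 z * h2 z)" "Hinf_T (\<lambda>z. g1 z * g2 z)"
      using 1 2 by (auto intro: Hinf_T_mult)
    show "AE t in circle_measure. g1 (cis t) * g2 (cis t) \<noteq> 0"
      using 1(3) 2(3) by eventually_elim simp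
    show "AE t in circle_measure. f1 (cis t) * f2 (cis t) = (h1 (cis t) * h2 (cis t)) / (g1 (cis t) * g2 (cis t))"
      using 1(4) 2(4) by eventually_elim simp
  qed
qed

text \<open>Boundary uniqueness applied to the numerator; this is what makes division
  possible.\<close>

lemma Nev_nonzero_AE:
  assumes "Nev f" "\<not> (AE t in circle_measure. f (cis t) = 0)"
  shows "AE t in circle_measure. f (cis t) \<noteq> 0"
proof -
  from assms(1) obtain h g where hg: "Hinf_T h" "AE t in circle_measure. g (cis t) \<noteq> 0"
    "AE t in circle_measure. f (cis t) = h (cis t) / g (cis t)" by (rule NevE)
  have "\<not> (AE t in circle_measure. h (cis t) = 0)"
  proof
    assume "AE t in circle_measure. h (cis t) = 0"
    with hg(3) have "AE t in circle_measure. f (cis t) = 0" by eventually_elim simp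
    with assms(2) show False ..
  qed
  then have "AE t in circle_measure. h (cis t) \<noteq> 0"
    using hg(1) hardy_inf_boundary_uniqueness unfolding Hinf_T_iff_hardy_inf by blast
  with hg(2,3) show ?thesis by eventually_elim simp
qed

lemma Nev_inverse:
  assumes "Nev f" shows "Nev (\<lambda>z. inverse (f z))"
proof (cases "AE t in circle_measure. f (cis t) = 0")
  \<comment> \<open>Since \<open>inverse 0 = 0\<close>, the inverse of a null function is again
    null.\<close>
  case True
  then have "AE t in circle_measure. inverse (f (cis t)) = 0" by eventually_elim simp
  then show ?thesis by (rule Nev_cong_AE[OF Nev_const])
next
  case False
  from assms obtain h g where hg: "Hinf_T h" "Hinf_T g"
    "AE t in circle_measure. f (cis t) = h (cis t) / g (cis t)" by (rule NevE)
  from Nev_nonzero_AE[OF assms False] hg(3)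
  have "AE t in circle_measure. h (cis t) \<noteq> 0" by eventually_elim auto
  moreover from hg(3) have "AE t in circle_measure. inverse (f (cis t)) = g (cis t) / h (cis t)"
    by eventually_elim simp
  ultimately show ?thesis by (rule NevI[OF hg(2,1)])
qed

lemma Nev_divide: "Nev f \<Longrightarrow> Nev g \<Longrightarrow> Nev (\<lambda>z. f z / g z)"
  unfolding divide_inverse by (intro Nev_mult Nev_inverse)

lemma Nev_sum: "(\<And>i. i \<in> I \<Longrightarrow> Nev (f i)) \<Longrightarrow> Nev (\<lambda>z. \<Sum>i\<in>I. f i z)"
  by (induction I rule: infinite_finite_induct) (auto intro: Nev_const Nev_add)

lemma Nev_prod: "(\<And>i. i \<in> I \<Longrightarrow> Nev (f i)) \<Longrightarrow> Nev (\<lambda>z. \<Prod>i\<in>I. f i z)"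
  by (induction I rule: infinite_finite_induct) (auto intro: Nev_const Nev_mult)

section \<open>Cramer's rule and the transfer of independence\<close>

lemma Nev_det:
  fixes M :: "complex \<Rightarrow> complex ^ 'm::finite ^ 'm"
  assumes "\<And>i j. Nev (\<lambda>z. M z $ i $ j)"
  shows "Nev (\<lambda>z. det (M z))"
  unfolding det_def by (intro Nev_sum Nev_mult Nev_const Nev_prod assms)

lemma Nev_vec_mult_iff:
  fixes A :: "complex \<Rightarrow> complex ^ 'm::finite ^ 'm" and v :: "complex \<Rightarrow> complex ^ 'm"
  assumes A: "\<And>i j. Nev (\<lambda>z. A z $ i $ j)"
    and nz: "\<not> (AE t in circle_measure. det (A (cis t)) = 0)"
  shows "Nev_vec (\<lambda>z. A z *v v z) \<longleftrightarrow> Nev_vec v"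
proof
  assume "Nev_vec v"
  then show "Nev_vec (\<lambda>z. A z *v v z)"
    unfolding Nev_vec_def matrix_vector_mult_def by (auto intro!: Nev_sum Nev_mult A)
next
  assume Av: "Nev_vec (\<lambda>z. A z *v v z)"
  show "Nev_vec v"
    unfolding Nev_vec_def
  proof
    fix k
    \<comment> \<open>\<open>A\<close> with its \<open>k\<close>-th column replaced by
      \<open>A *v v\<close>; its determinant is the \<open>k\<close>-th entry of \<open>v\<close>
      times \<open>det A\<close>, and all its entries are Nevanlinna.\<close>
    define C where "C z = (\<chi> i j. if j = k then (A z *v v z) $ i else A z $ i $ j)" for z
    have "Nev (\<lambda>z. C z $ i $ j)" for i j
      using A Av by (cases "j = k") (simp_all add: C_def Nev_vec_def)
    then have "Nev (\<lambda>z. det (C z) / det (A z))"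
      by (intro Nev_divide Nev_det A)
    moreover have "AE t in circle_measure. det (A (cis t)) \<noteq> 0"
      by (rule Nev_nonzero_AE[OF Nev_det[OF A] nz])
    then have "AE t in circle_measure. v (cis t) $ k = det (C (cis t)) / det (A (cis t))"
    proof eventually_elim
      case (elim t)
      then show ?case by (simp add: C_def cramer_lemma)
    qed
    ultimately show "Nev (\<lambda>z. v z $ k)" by (rule Nev_cong_AE)
  qed
qed

lemma sum_scale_column_mult:
  fixes A :: "complex ^ 'm::finite ^ 'm" and B :: "complex ^ 'r::finite ^ 'm"
  shows "(\<Sum>j\<in>S. a j *s column j (A ** B)) = A *v (\<Sum>j\<in>S. a j *s column j B)"
proof -
  have "(\<Sum>j\<in>S. a j * (\<Sum>k\<in>UNIV. A $ i $ k * B $ k $ j)) = (\<Sum>k\<in>UNIV. A $ i $ k * (\<Sum>j\<in>S. a j * B $ k $ j))" for i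
    by (simp add: sum_distrib_left sum.swap[of _ S] mult_ac)
  then show ?thesis
    by (simp add: vec_eq_iff column_def matrix_matrix_mult_def matrix_vector_mult_def)
qed

theorem mainTheorem2:
  fixes A :: "complex \<Rightarrow> complex ^ 'm::finite ^ 'm"
    and \<Phi> :: "complex \<Rightarrow> complex ^ 'r::finite ^ 'm"
  assumes "\<forall>i j. Nev_inf (\<lambda>z. A z $ i $ j)"
    and "\<not> (AE t in circle_measure. det (A (cis t)) = 0)"
    and "\<forall>i j. L2_T (\<lambda>z. \<Phi> z $ i $ j)"
  shows "ind_N (\<lambda>j z. column j (\<Phi> z)) = ind_N (\<lambda>j z. column j (A z ** \<Phi> z))"
proof -
  have "Nev (\<lambda>z. A z $ i $ j)" for i j
    using assms(1) by (simp add: Nev_inf_def)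
  from Nev_vec_mult_iff[OF this assms(2)]
  \<comment> \<open>Pulling \<open>A\<close> out of the sum leaves the same condition on the same
    coefficients, so both families have the same independent index sets, not only the same maximal
    size.\<close>
  have "indep_mod_N (\<lambda>j z. column j (A z ** \<Phi> z)) S \<longleftrightarrow> indep_mod_N (\<lambda>j z. column j (\<Phi> z)) S" for S
    unfolding indep_mod_N_def sum_scale_column_mult by simp
  then show ?thesis by (simp add: ind_N_def)
qed

end
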